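(* Let $K$ be a finite field, let $S=K[t_1,\ldots,t_s]$, let $S^*=S\setminus\{0\}$, and let $\prec$ be the graded reverse lexicographical order on $S$. Let $\mathcal{L}=KA$ be the linear subspace of $S$ generated by a finite subset $A$ of $S^*$. Then the following algorithm terminates after finitely many steps and its output is a $K$-basis of $\mathcal{L}$: start with $B:=A$; while $B\neq\emptyset$, add $\max(B)$ to the output list and replace $B$ by $\phi(B)$.
   Context: $KA$ is the $K$-span of $A$. For $g\in S^*$, $\mathrm{in}_\prec(g)$ and $\mathrm{lc}(g)$ denote its initial monomial and leading coefficient with respect to $\prec$. For a finite nonempty subset $B\subset S^*$: - $\max(B)$ is any (chosen) polynomial in $B$ whose initial monomial is $\max\{\mathrm{in}_\prec(g): g\in B\}$ (the same choice is used in listing $\max(B)$ and in computing $\phi(B)$); - $\sigma(B)=\{g\in B: \mathrm{in}_\prec(g)=\mathrm{in}_\prec(\max(B))\}$, the set of polynomials in $B$ with largest initial monomial; - $\phi(B)=\left(\left\{\max(B)-\dfrac{\mathrm{lc}(\max(B))}{\mathrm{lc}(g)}\,g : g\in\sigma(B)\right\}\setminus\{0\}\right)\cup(B\setminus\sigma(B))$, again a finite subset of $S^*$. Thus the output is the list $\max(A),\max(\phi(A)),\max(\phi^2(A)),\ldots,\max(\phi^{k-1}(A))$ where $k$ is the first integer with $\phi^k(A)=\emptyset$. *)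

theory Defs
  imports Complex_Main "HOL-Library.Poly_Mapping" "HOL-Library.While_Combinator"
begin

text \<open>
  Monomials are finitely supported exponent functions on \<open>nat\<close>, polynomials are finitely
  supported coefficient functions on monomials; the index \<open>i\<close> stands for the variable \<open>t\<^sub>i\<close>.
\<close>

type_synonym monomial = "nat \<Rightarrow>\<^sub>0 nat"
type_synonym 'k mpoly = "monomial \<Rightarrow>\<^sub>0 'k"

text \<open>The polynomials of \<open>K[t\<^sub>1,\<dots>,t\<^sub>s]\<close>, and those different from zero.\<close>

definition polys :: "nat \<Rightarrow> 'k::zero mpoly set" where
  "polys s = {p. \<forall>m\<in>Poly_Mapping.keys p. Poly_Mapping.keys m \<subseteq> {1..s}}"

definition nonzero_polys :: "nat \<Rightarrow> 'k::zero mpoly set" where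
  "nonzero_polys s = polys s - {0}"

definition scale :: "'k::mult_zero \<Rightarrow> 'k mpoly \<Rightarrow> 'k mpoly" where
  "scale c p = Poly_Mapping.map (\<lambda>x. c * x) p"

lemma lookup_scale [simp]:
  "Poly_Mapping.lookup (scale c p) m = c * Poly_Mapping.lookup p m"
  unfolding scale_def by transfer (simp add: when_def)

global_interpretation mpoly: vector_space "scale :: 'k::field \<Rightarrow> 'k mpoly \<Rightarrow> 'k mpoly"
  by standard (rule poly_mapping_eqI; simp add: lookup_add distrib_left distrib_right mult.assoc)+

definition mdeg :: "monomial \<Rightarrow> nat" where
  "mdeg m = (\<Sum>i\<in>Poly_Mapping.keys m. Poly_Mapping.lookup m i)"

text \<open>
  Graded reverse lexicographical order with \<open>t\<^sub>1 \<succ> t\<^sub>2 \<succ> \<dots> \<succ> t\<^sub>s\<close>: in equal degrees, \<open>a \<prec> b\<close> iff the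
  last nonzero entry of \<open>b - a\<close> is negative.
\<close>

definition grevlex_less :: "monomial \<Rightarrow> monomial \<Rightarrow> bool" where
  "grevlex_less a b \<longleftrightarrow> mdeg a < mdeg b \<or>
     mdeg a = mdeg b \<and>
     (\<exists>i. Poly_Mapping.lookup b i < Poly_Mapping.lookup a i \<and>
          (\<forall>j>i. Poly_Mapping.lookup b j = Poly_Mapping.lookup a j))"

definition grevlex_le :: "monomial \<Rightarrow> monomial \<Rightarrow> bool" where
  "grevlex_le a b \<longleftrightarrow> a = b \<or> grevlex_less a b"

lemma grevlex_less_irrefl: "\<not> grevlex_less a a"
  by (simp add: grevlex_less_def)

lemma grevlex_less_trans:
  assumes "grevlex_less a b" "grevlex_less b c"
  shows "grevlex_less a c"
proof (cases "mdeg a < mdeg b \<or> mdeg b < mdeg c")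
  case True
  then show ?thesis using assms by (auto simp: grevlex_less_def)
next
  case False
  then obtain i j where
    i: "Poly_Mapping.lookup b i < Poly_Mapping.lookup a i"
       "\<forall>k>i. Poly_Mapping.lookup b k = Poly_Mapping.lookup a k" and
    j: "Poly_Mapping.lookup c j < Poly_Mapping.lookup b j"
       "\<forall>k>j. Poly_Mapping.lookup c k = Poly_Mapping.lookup b k" and
    deg: "mdeg a = mdeg b" "mdeg b = mdeg c"
    using assms by (auto simp: grevlex_less_def)
  have "Poly_Mapping.lookup c (max i j) < Poly_Mapping.lookup a (max i j)"
  proof (cases i j rule: linorder_cases)
    case less
    then show ?thesis using i(2) j(1) by (simp add: max_def)
  next
    case equal
    then show ?thesis using i(1) j(1) by simp
  next
    case greater
    then show ?thesis using i(1) j(2) by (simp add: max_def)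
  qed
  moreover have "\<forall>k>max i j. Poly_Mapping.lookup c k = Poly_Mapping.lookup a k"
    using i(2) j(2) by simp
  ultimately show ?thesis
    using deg unfolding grevlex_less_def by (intro disjI2 conjI exI[of _ "max i j"]) simp_all
qed

lemma grevlex_less_total:
  assumes "a \<noteq> b"
  shows "grevlex_less a b \<or> grevlex_less b a"
proof (cases "mdeg a = mdeg b")
  case True
  define D where "D = {i. Poly_Mapping.lookup a i \<noteq> Poly_Mapping.lookup b i}"
  have "D \<subseteq> Poly_Mapping.keys a \<union> Poly_Mapping.keys b"
    by (auto simp: D_def in_keys_iff)
  then have "finite D" by (rule finite_subset) simp
  moreover have "D \<noteq> {}"
    using assms by (auto simp: D_def intro: poly_mapping_eqI)
  ultimately have "Max D \<in> D"
    by (rule Max_in)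
  then have "Poly_Mapping.lookup a (Max D) \<noteq> Poly_Mapping.lookup b (Max D)"
    by (simp add: D_def)
  moreover have "Poly_Mapping.lookup a j = Poly_Mapping.lookup b j" if "j > Max D" for j
    using that Max_ge[OF \<open>finite D\<close>, of j] unfolding D_def by fastforce
  ultimately show ?thesis
    using True unfolding grevlex_less_def by (metis linorder_neqE_nat)
qed (auto simp: grevlex_less_def)

global_interpretation grevlex: linorder grevlex_le grevlex_less
proof
  fix a b c :: monomial
  show "grevlex_less a b = (grevlex_le a b \<and> \<not> grevlex_le b a)"
    unfolding grevlex_le_def using grevlex_less_irrefl grevlex_less_trans by metis
  show "grevlex_le a a"
    by (simp add: grevlex_le_def)
  show "grevlex_le a c" if "grevlex_le a b" "grevlex_le b c"
    using that grevlex_less_trans unfolding grevlex_le_def by metis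
  show "a = b" if "grevlex_le a b" "grevlex_le b a"
    using that grevlex_less_irrefl grevlex_less_trans unfolding grevlex_le_def by metis
  show "grevlex_le a b \<or> grevlex_le b a"
    using grevlex_less_total unfolding grevlex_le_def by metis
qed

definition initial :: "'k::zero mpoly \<Rightarrow> monomial" where
  "initial g = grevlex.Max (Poly_Mapping.keys g)"

definition lc :: "'k::zero mpoly \<Rightarrow> 'k" where
  "lc g = Poly_Mapping.lookup g (initial g)"

text \<open>
  A choice function \<open>B \<mapsto> max(B)\<close>. It fixes one choice for every \<open>B\<close>, so the polynomial
  \<open>max(B)\<close> that is output is the one used in \<open>\<phi>(B)\<close>.
\<close>

definition max_choice :: "nat \<Rightarrow> ('k::zero mpoly set \<Rightarrow> 'k mpoly) \<Rightarrow> bool" where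
  "max_choice s mx \<longleftrightarrow>
     (\<forall>B. finite B \<and> B \<noteq> {} \<and> B \<subseteq> nonzero_polys s \<longrightarrow>
        mx B \<in> B \<and> initial (mx B) = grevlex.Max (initial ` B))"

definition sigma :: "('k::zero mpoly set \<Rightarrow> 'k mpoly) \<Rightarrow> 'k mpoly set \<Rightarrow> 'k mpoly set" where
  "sigma mx B = {g \<in> B. initial g = initial (mx B)}"

definition phi :: "('k::field mpoly set \<Rightarrow> 'k mpoly) \<Rightarrow> 'k mpoly set \<Rightarrow> 'k mpoly set" where
  "phi mx B =
     ((\<lambda>g. mx B - scale (lc (mx B) / lc g) g) ` sigma mx B - {0}) \<union> (B - sigma mx B)"

text \<open>The result is \<open>None\<close> iff the loop does not terminate.\<close>

definition basis_algorithm ::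
    "('k::field mpoly set \<Rightarrow> 'k mpoly) \<Rightarrow> 'k mpoly set \<Rightarrow> 'k mpoly list option" where
  "basis_algorithm mx A =
     map_option snd
       (while_option (\<lambda>(B, out). B \<noteq> {}) (\<lambda>(B, out). (phi mx B, out @ [mx B])) (A, []))"

end

theory Submission
  imports Defs
begin

text \<open>
  The algorithm is Gaussian elimination on initial monomials. One round on a nonempty \<open>B\<close> keeps the
  pivot \<open>mx B\<close>, cancels the monomial \<open>initial (mx B)\<close> from all the other polynomials that contain
  it, and leaves \<open>phi mx B\<close>. Three facts about a round carry the proof.

  \<^item> The elimination step is invertible as long as the pivot is remembered, so
    \<open>insert (mx B) (phi mx B)\<close> and \<open>B\<close> have the same span (\<open>span_insert_phi\<close>).
  \<^item> No element of \<open>phi mx B\<close> contains the monomial \<open>initial (mx B)\<close>, a property that is inherited by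
    linear combinations, whereas the pivot does contain it. Thus \<open>mx B\<close> is independent of everything
    produced later (\<open>max_notin_span_phi\<close>).
  \<^item> The pivot cancels itself and \<open>0\<close> is discarded, so every round makes the set smaller
    (\<open>card_phi_less\<close>).

  Induction on the cardinality of \<open>B\<close> then yields termination and the basis property together: the
  rounds after the first return a basis of the span of \<open>phi mx B\<close>, and adding the pivot to it gives a
  basis of the span of \<open>B\<close>.
\<close>

lemma lookup_initial_nonzero:
  assumes "g \<noteq> 0"
  shows "Poly_Mapping.lookup g (initial g) \<noteq> 0"
proof -
  have "initial g \<in> Poly_Mapping.keys g"
    unfolding initial_def by (rule grevlex.Max_in) (use assms in auto)
  then show ?thesis by (simp add: in_keys_iff)
qed

lemma lookup_above_initial:
  assumes "grevlex_less (initial g) m"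
  shows "Poly_Mapping.lookup g m = 0"
proof (rule ccontr)
  assume "Poly_Mapping.lookup g m \<noteq> 0"
  then have "grevlex_le m (initial g)"
    unfolding initial_def by (intro grevlex.Max_ge) (auto simp: in_keys_iff)
  then show False using assms by auto
qed

lemma lookup_span_eq_0:
  assumes "p \<in> mpoly.span X" and "\<And>g. g \<in> X \<Longrightarrow> Poly_Mapping.lookup g m = 0"
  shows "Poly_Mapping.lookup p m = 0"
  using assms(1)
  by (induction rule: mpoly.span_induct_alt) (auto simp: lookup_add assms(2))

lemma diff_scale_in_polys:
  fixes p q :: "'k::field mpoly"
  assumes "p \<in> polys s" "q \<in> polys s"
  shows "p - scale c q \<in> polys s"
proof -
  have "Poly_Mapping.keys (p - scale c q) \<subseteq> Poly_Mapping.keys p \<union> Poly_Mapping.keys q"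
    by (auto simp: in_keys_iff lookup_minus)
  then show ?thesis using assms by (fastforce simp: polys_def)
qed

locale elimination_round =
  fixes s :: nat and mx :: "'k::field mpoly set \<Rightarrow> 'k mpoly" and B :: "'k mpoly set"
  assumes choice: "max_choice s mx"
    and fin: "finite B" and nonempty: "B \<noteq> {}" and sub: "B \<subseteq> nonzero_polys s"
begin

lemma max_in: "mx B \<in> B"
  and initial_max: "initial (mx B) = grevlex.Max (initial ` B)"
  using choice fin nonempty sub unfolding max_choice_def by blast+

lemma nonzero: "g \<in> B \<Longrightarrow> g \<noteq> 0"
  using sub by (auto simp: nonzero_polys_def)

lemma lc_nonzero: "g \<in> B \<Longrightarrow> lc g \<noteq> 0"
  unfolding lc_def by (intro lookup_initial_nonzero nonzero)

lemma max_in_sigma: "mx B \<in> sigma mx B"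
  using max_in by (simp add: sigma_def)

lemma sigma_subset: "sigma mx B \<subseteq> B"
  by (auto simp: sigma_def)

lemma finite_sigma: "finite (sigma mx B)"
  using sigma_subset fin by (rule finite_subset)

lemma finite_phi: "finite (phi mx B)"
  using fin finite_sigma by (simp add: phi_def)

lemma phi_subset_nonzero_polys: "phi mx B \<subseteq> nonzero_polys s"
  using max_in sub sigma_subset diff_scale_in_polys
  unfolding phi_def nonzero_polys_def by blast

text \<open>The pivot lies in its own \<open>sigma\<close> and is sent to \<open>0\<close>, so at least one element is lost.\<close>

lemma card_phi_less: "card (phi mx B) < card B"
proof -
  let ?f = "\<lambda>g. mx B - scale (lc (mx B) / lc g) g"
  have "?f (mx B) = 0"
    using lc_nonzero[OF max_in] by simp
  then have "?f ` sigma mx B - {0} \<subseteq> ?f ` (sigma mx B - {mx B})"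
    by auto
  then have "card (?f ` sigma mx B - {0}) \<le> card (sigma mx B - {mx B})"
    using finite_sigma by (meson card_image_le card_mono finite_Diff finite_imageI le_trans)
  also have "\<dots> < card (sigma mx B)"
    using finite_sigma max_in_sigma by (rule card_Diff1_less)
  finally have "card (phi mx B) < card (sigma mx B) + card (B - sigma mx B)"
    unfolding phi_def by (intro le_less_trans[OF card_Un_le]) simp
  also have "\<dots> = card B"
    using fin sigma_subset finite_sigma by (simp add: card_Diff_subset card_mono)
  finally show ?thesis .
qed

text \<open>
  Elements of \<open>sigma\<close> lose the leading monomial by cancellation of leading coefficients; the others
  never had it, because their own initial monomial is strictly smaller.
\<close>

lemma lookup_phi_initial_max:
  assumes "h \<in> phi mx B"
  shows "Poly_Mapping.lookup h (initial (mx B)) = 0"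
  using assms unfolding phi_def
proof (elim UnE DiffE imageE)
  fix g assume g: "g \<in> sigma mx B" and h: "h = mx B - scale (lc (mx B) / lc g) g"
  have "Poly_Mapping.lookup g (initial (mx B)) = lc g" "lc g \<noteq> 0"
    using g lc_nonzero[of g] by (simp_all add: sigma_def lc_def)
  then show ?thesis by (simp add: h lookup_minus lc_def[of "mx B"])
next
  assume h: "h \<in> B" "h \<notin> sigma mx B"
  then have "grevlex_le (initial h) (initial (mx B))"
    unfolding initial_max using fin by (intro grevlex.Max_ge) auto
  moreover have "initial h \<noteq> initial (mx B)"
    using h by (simp add: sigma_def)
  ultimately show ?thesis
    by (intro lookup_above_initial) (simp add: grevlex_le_def)
qed

lemma max_notin_span_phi: "mx B \<notin> mpoly.span (phi mx B)"
  using lookup_span_eq_0[OF _ lookup_phi_initial_max]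
    lookup_initial_nonzero[OF nonzero[OF max_in]] by blast

text \<open>
  A reduced polynomial \<open>mx B - scale c g\<close> has \<open>c \<noteq> 0\<close>, so \<open>g\<close> can be solved for; this remains valid
  when the reduced polynomial is \<open>0\<close> and was discarded.
\<close>

lemma span_insert_phi: "mpoly.span (insert (mx B) (phi mx B)) = mpoly.span B"
proof (rule mpoly.span_eq[THEN iffD2], intro conjI subsetI)
  fix h assume "h \<in> insert (mx B) (phi mx B)"
  then show "h \<in> mpoly.span B"
    using max_in sigma_subset unfolding phi_def
    by (auto intro!: mpoly.span_diff mpoly.span_scale intro: mpoly.span_base)
next
  let ?X = "insert (mx B) (phi mx B)"
  fix g assume g: "g \<in> B"
  show "g \<in> mpoly.span ?X"
  proof (cases "g \<in> sigma mx B")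
    case False
    then show ?thesis using g by (intro mpoly.span_base) (simp add: phi_def)
  next
    case True
    define c where "c = lc (mx B) / lc g"
    define h where "h = mx B - scale c g"
    have "c \<noteq> 0"
      using lc_nonzero[OF g] lc_nonzero[OF max_in] by (simp add: c_def)
    have "h = 0 \<or> h \<in> phi mx B"
      using True by (auto simp: phi_def h_def c_def)
    then have "h \<in> mpoly.span ?X"
      by (auto intro: mpoly.span_base mpoly.span_zero)
    then have "scale (inverse c) (mx B - h) \<in> mpoly.span ?X"
      by (intro mpoly.span_scale mpoly.span_diff) (auto intro: mpoly.span_base)
    also have "scale (inverse c) (mx B - h) = g"
      using \<open>c \<noteq> 0\<close> by (simp add: h_def)
    finally show ?thesis .
  qed
qed

end

text \<open>
  The accumulator is arbitrary because the loop, unfolded once, continues with a nonempty output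
  list; only what is appended to it is asserted to be a basis.
\<close>

lemma while_elimination_appends_basis:
  fixes mx :: "'k::field mpoly set \<Rightarrow> 'k mpoly"
  assumes "max_choice s mx" "finite B" "B \<subseteq> nonzero_polys s"
  shows "\<exists>out.
    while_option (\<lambda>(B, out). B \<noteq> {}) (\<lambda>(B, out). (phi mx B, out @ [mx B])) (B, acc)
      = Some ({}, acc @ out) \<and>
    distinct out \<and> mpoly.independent (set out) \<and> mpoly.span (set out) = mpoly.span B"
  using assms(2,3)
proof (induction "card B" arbitrary: B acc rule: less_induct)
  case less
  show ?case
  proof (cases "B = {}")
    case True
    then show ?thesis
      by (intro exI[of _ "[]"]) (simp add: while_option_unfold mpoly.independent_empty)
  next
    case False
    interpret elimination_round s mx B
      using assms(1) less.prems False by unfold_locales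
    obtain out where
      run: "while_option (\<lambda>(B, out). B \<noteq> {}) (\<lambda>(B, out). (phi mx B, out @ [mx B]))
              (phi mx B, acc @ [mx B]) = Some ({}, (acc @ [mx B]) @ out)" and
      out: "distinct out" "mpoly.independent (set out)"
           "mpoly.span (set out) = mpoly.span (phi mx B)"
      using less.hyps[OF card_phi_less finite_phi phi_subset_nonzero_polys] by blast
    have new: "mx B \<notin> mpoly.span (set out)"
      using max_notin_span_phi out(3) by simp
    then have "distinct (mx B # out)"
      using out(1) by (auto intro: mpoly.span_base)
    moreover have "mpoly.independent (set (mx B # out))"
      using new out(2) by (simp add: mpoly.independent_insertI)
    moreover have "mpoly.span (set (mx B # out)) = mpoly.span B"
      using out(3) by (simp add: span_insert_phi[symmetric] mpoly.span_insert)
    ultimately show ?thesis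
      using False run by (intro exI[of _ "mx B # out"]) (simp add: while_option_unfold)
  qed
qed

theorem theorem3p11:
  fixes s :: nat
    and A :: "'k::{field,finite} mpoly set"
    and mx :: "'k mpoly set \<Rightarrow> 'k mpoly"
  assumes "finite A"
    and "A \<subseteq> nonzero_polys s"
    and "max_choice s mx"
  shows "\<exists>out. basis_algorithm mx A = Some out \<and>
           distinct out \<and>
           mpoly.independent (set out) \<and>
           mpoly.span (set out) = mpoly.span A"
  using while_elimination_appends_basis[OF assms(3,1,2), of "[]"]
  by (auto simp: basis_algorithm_def)

end
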